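(* Let $A$ be a $J$-self-adjoint operator in the Krein space $(\mathfrak{H},[\cdot,\cdot])$, $[x,y]=(Jx,y)$. Then $A$ has the property of $\mathcal{C}$-symmetry if and only if there exists a maximal uniformly positive subspace $\mathfrak{L}_+$ of $(\mathfrak{H},[\cdot,\cdot])$ such that, with $\mathfrak{L}_-=\mathfrak{L}_+^{[\bot]}$, one has the $J$-orthogonal direct decomposition $\mathfrak{H}=\mathfrak{L}_+[\dot{+}]\mathfrak{L}_-$ and $A$ admits the decomposition $$A=A_+[\dot{+}]A_-,\qquad A_+=A\upharpoonright\mathfrak{L}_+,\quad A_-=A\upharpoonright\mathfrak{L}_-$$ with respect to it.
   Context: Setting. $\mathfrak{H}$ is a complex Hilbert space with scalar product $(\cdot,\cdot)$, and $J$ is a fundamental symmetry: $J=J^*$, $J^2=I$. Put $P_\pm=\frac12(I\pm J)$, $\mathfrak{H}_\pm=P_\pm\mathfrak{H}$, and assume $\dim\mathfrak{H}_+=\dim\mathfrak{H}_-=\infty$. With the indefinite metric $[x,y]:=(Jx,y)$, $(\mathfrak{H},[\cdot,\cdot])$ is called a Krein space. Subspaces. "Subspace" means closed linear subspace. A subspace $\mathfrak{L}$ is uniformly positive if there is $\alpha>0$ with $[x,x]\ge\alpha\|x\|^2$ for all $x\in\mathfrak{L}$; it is maximal uniformly positive if it is not properly contained in another uniformly positive subspace. $\mathfrak{L}^{[\bot]}=\{x\in\mathfrak{H}: [x,y]=0\ \forall y\in\mathfrak{L}\}$. The symbol $[\dot{+}]$ denotes a direct sum whose summands are orthogonal with respect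 to $[\cdot,\cdot]$. $J$-self-adjointness. A densely defined linear operator $A$ in $\mathfrak{H}$ is $J$-self-adjoint if $A^*J=JA$ (equality of operators, including domains). $\mathcal{C}$-symmetry. A $J$-self-adjoint operator $A$ has the property of $\mathcal{C}$-symmetry if there exists a bounded linear operator $\mathcal{C}$ on $\mathfrak{H}$ such that (i) $\mathcal{C}^2=I$; (ii) $J\mathcal{C}>0$, i.e. $J\mathcal{C}$ is self-adjoint and $(J\mathcal{C}x,x)>0$ for all $x\ne0$; (iii) $A\mathcal{C}=\mathcal{C}A$ (equality of operators with their natural domains). Decomposition of $A$. "$A=A_+[\dot{+}]A_-$ with respect to $\mathfrak{L}_+[\dot{+}]\mathfrak{L}_-$" means: $\mathcal{D}(A)=(\mathcal{D}(A)\cap\mathfrak{L}_+)\dot{+}(\mathcal{D}(A)\cap\mathfrak{L}_-)$ and $A$ maps $\mathcal{D}(A)\cap\mathfrak{L}_\pm$ into $\mathfrak{L}_\pm$; $A_\pm$ is the restriction of $A$ to $\mathcal{D}(A)\cap\mathfrak{L}_\pm$, regarded as an operator in $\mathfrak{L}_\pm$. *)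

theory Defs
  imports "HOL-Analysis.Analysis"
begin

section \<open>Complex Hilbert spaces\<close>

text \<open>
  The scalar product is linear in its first argument. Its real part is the real inner product
  of \<^class>\<open>real_inner\<close>, so positive definiteness, the norm and the topology are inherited from there.
\<close>

class complex_hilbert_space = real_inner + complete_space +
  fixes scaleC :: "complex \<Rightarrow> 'a \<Rightarrow> 'a"  (infixr "*\<^sub>C" 75)
    and cinner :: "'a \<Rightarrow> 'a \<Rightarrow> complex"
  assumes scaleC_add_right: "a *\<^sub>C (x + y) = a *\<^sub>C x + a *\<^sub>C y"
    and scaleC_add_left: "(a + b) *\<^sub>C x = a *\<^sub>C x + b *\<^sub>C x"
    and scaleC_scaleC: "a *\<^sub>C b *\<^sub>C x = (a * b) *\<^sub>C x"
    and scaleC_one: "1 *\<^sub>C x = x"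
    and scaleR_scaleC: "r *\<^sub>R x = complex_of_real r *\<^sub>C x"
    and cinner_commute: "cinner x y = cnj (cinner y x)"
    and cinner_add_left: "cinner (x + y) z = cinner x z + cinner y z"
    and cinner_scaleC_left: "cinner (a *\<^sub>C x) y = a * cinner x y"
    and inner_eq_Re_cinner: "x \<bullet> y = Re (cinner x y)"

global_interpretation complex_vector:
  vector_space "scaleC :: complex \<Rightarrow> 'a \<Rightarrow> 'a::complex_hilbert_space"
  defines csubspace = complex_vector.subspace
    and cspan = complex_vector.span
  by unfold_locales
    (simp_all add: scaleC_add_right scaleC_add_left scaleC_scaleC scaleC_one)

definition closed_csubspace :: "'a::complex_hilbert_space set \<Rightarrow> bool"
  where "closed_csubspace L \<longleftrightarrow> csubspace L \<and> closed L"

definition infinite_dimensional :: "'a::complex_hilbert_space set \<Rightarrow> bool"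
  where "infinite_dimensional L \<longleftrightarrow> \<not> (\<exists>B. finite B \<and> cspan B = L)"

definition direct_sum ::
    "'a::complex_hilbert_space set \<Rightarrow> 'a set \<Rightarrow> 'a set \<Rightarrow> bool"
  where "direct_sum S M N \<longleftrightarrow> S = {x + y |x y. x \<in> M \<and> y \<in> N} \<and> M \<inter> N = {0}"


section \<open>Operators\<close>

text \<open>
  An operator with domain is a partial function, with \<^const>\<open>dom\<close> as its domain. Equality is then
  equality including domains, \<^term>\<open>A \<circ>\<^sub>m B\<close> is the product with its natural domain, and
  \<^term>\<open>A |` L\<close> is the restriction of \<^term>\<open>A\<close> to \<^term>\<open>dom A \<inter> L\<close>.
\<close>

abbreviation everywhere :: "('a \<Rightarrow> 'a) \<Rightarrow> 'a \<rightharpoonup> 'a"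
  where "everywhere T \<equiv> Some \<circ> T"

definition linear_operator :: "('a::complex_hilbert_space \<rightharpoonup> 'a) \<Rightarrow> bool"
  where "linear_operator A \<longleftrightarrow> csubspace (dom A) \<and>
    (\<forall>x\<in>dom A. \<forall>y\<in>dom A. the (A (x + y)) = the (A x) + the (A y)) \<and>
    (\<forall>c. \<forall>x\<in>dom A. the (A (c *\<^sub>C x)) = c *\<^sub>C the (A x))"

definition densely_defined :: "('a::complex_hilbert_space \<rightharpoonup> 'a) \<Rightarrow> bool"
  where "densely_defined A \<longleftrightarrow> closure (dom A) = UNIV"

text \<open>The \<open>z\<close> below is unique whenever \<open>A\<close> is densely defined.\<close>

definition op_adjoint :: "('a::complex_hilbert_space \<rightharpoonup> 'a) \<Rightarrow> 'a \<rightharpoonup> 'a"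
  where "op_adjoint A = (\<lambda>y.
    if \<exists>z. \<forall>x\<in>dom A. cinner (the (A x)) y = cinner x z
    then Some (THE z. \<forall>x\<in>dom A. cinner (the (A x)) y = cinner x z)
    else None)"

definition bounded_clinear :: "('a::complex_hilbert_space \<Rightarrow> 'a) \<Rightarrow> bool"
  where "bounded_clinear T \<longleftrightarrow> bounded_linear T \<and> (\<forall>c x. T (c *\<^sub>C x) = c *\<^sub>C T x)"

definition bounded_self_adjoint :: "('a::complex_hilbert_space \<Rightarrow> 'a) \<Rightarrow> bool"
  where "bounded_self_adjoint T \<longleftrightarrow>
    bounded_clinear T \<and> op_adjoint (everywhere T) = everywhere T"

definition positive_operator :: "('a::complex_hilbert_space \<Rightarrow> 'a) \<Rightarrow> bool"
  where "positive_operator T \<longleftrightarrow>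
    bounded_self_adjoint T \<and> (\<forall>x. x \<noteq> 0 \<longrightarrow> Re (cinner (T x) x) > 0)"
  \<comment> \<open>the form is real because \<open>T\<close> is self-adjoint\<close>


section \<open>Krein spaces\<close>

definition fundamental_symmetry :: "('a::complex_hilbert_space \<Rightarrow> 'a) \<Rightarrow> bool"
  where "fundamental_symmetry J \<longleftrightarrow> bounded_self_adjoint J \<and> J \<circ> J = id"

definition P_plus :: "('a::complex_hilbert_space \<Rightarrow> 'a) \<Rightarrow> 'a \<Rightarrow> 'a"
  where "P_plus J x = (1/2) *\<^sub>C (x + J x)"

definition P_minus :: "('a::complex_hilbert_space \<Rightarrow> 'a) \<Rightarrow> 'a \<Rightarrow> 'a"
  where "P_minus J x = (1/2) *\<^sub>C (x - J x)"

definition krein_inner :: "('a::complex_hilbert_space \<Rightarrow> 'a) \<Rightarrow> 'a \<Rightarrow> 'a \<Rightarrow> complex"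
  where "krein_inner J x y = cinner (J x) y"

definition krein_complement ::
    "('a::complex_hilbert_space \<Rightarrow> 'a) \<Rightarrow> 'a set \<Rightarrow> 'a set"
  where "krein_complement J L = {x. \<forall>y\<in>L. krein_inner J x y = 0}"

definition krein_direct_sum ::
    "('a::complex_hilbert_space \<Rightarrow> 'a) \<Rightarrow> 'a set \<Rightarrow> 'a set \<Rightarrow> 'a set \<Rightarrow> bool"
  where "krein_direct_sum J S M N \<longleftrightarrow>
    direct_sum S M N \<and> (\<forall>x\<in>M. \<forall>y\<in>N. krein_inner J x y = 0)"

text \<open>\<^term>\<open>krein_inner J x x\<close> is real for a fundamental symmetry \<open>J\<close>.\<close>

definition uniformly_positive ::
    "('a::complex_hilbert_space \<Rightarrow> 'a) \<Rightarrow> 'a set \<Rightarrow> bool"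
  where "uniformly_positive J L \<longleftrightarrow> closed_csubspace L \<and>
    (\<exists>\<alpha>>0. \<forall>x\<in>L. Re (krein_inner J x x) \<ge> \<alpha> * (norm x)\<^sup>2)"

definition maximal_uniformly_positive ::
    "('a::complex_hilbert_space \<Rightarrow> 'a) \<Rightarrow> 'a set \<Rightarrow> bool"
  where "maximal_uniformly_positive J L \<longleftrightarrow>
    uniformly_positive J L \<and> \<not> (\<exists>M. uniformly_positive J M \<and> L \<subset> M)"

definition J_self_adjoint ::
    "('a::complex_hilbert_space \<Rightarrow> 'a) \<Rightarrow> ('a \<rightharpoonup> 'a) \<Rightarrow> bool"
  where "J_self_adjoint J A \<longleftrightarrow> linear_operator A \<and> densely_defined A \<and>
    op_adjoint A \<circ>\<^sub>m everywhere J = everywhere J \<circ>\<^sub>m A"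

definition has_C_symmetry ::
    "('a::complex_hilbert_space \<Rightarrow> 'a) \<Rightarrow> ('a \<rightharpoonup> 'a) \<Rightarrow> bool"
  where "has_C_symmetry J A \<longleftrightarrow>
    (\<exists>C. bounded_clinear C \<and> C \<circ> C = id \<and> positive_operator (J \<circ> C) \<and>
      A \<circ>\<^sub>m everywhere C = everywhere C \<circ>\<^sub>m A)"

text \<open>\<open>A\<close> is the direct sum of its parts \<^term>\<open>A |` M\<close> in \<open>M\<close> and \<^term>\<open>A |` N\<close> in \<open>N\<close>.\<close>

definition decomposes ::
    "('a::complex_hilbert_space \<rightharpoonup> 'a) \<Rightarrow> 'a set \<Rightarrow> 'a set \<Rightarrow> bool"
  where "decomposes A M N \<longleftrightarrow>
    direct_sum (dom A) (dom A \<inter> M) (dom A \<inter> N) \<and>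
    ran (A |` M) \<subseteq> M \<and> ran (A |` N) \<subseteq> N"

end

theory Submission
  imports Defs
begin

text \<open>
  A bounded involution \<open>C\<close> amounts to the splitting of the space into its eigenspaces for \<open>1\<close> and \<open>-1\<close>,
  and \<open>C\<close> commutes with \<open>A\<close> exactly if this splitting decomposes \<open>A\<close>. If \<open>J C > 0\<close>, then \<open>J C\<close> has
  the bounded inverse \<open>C J\<close>, so it is bounded below; hence the first eigenspace is uniformly
  positive, its Krein complement is the second one, and it is maximal because the second one is
  negative. Conversely, for a maximal uniformly positive \<open>L\<close> with complement \<open>M\<close>, uniform positivity
  bounds the projection onto \<open>L\<close> along \<open>M\<close>, and maximality makes \<open>M\<close> negative definite: a positive
  vector of \<open>M\<close> could be adjoined to \<open>L\<close>, and a neutral one would be Krein-orthogonal to everything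
  by the Cauchy--Schwarz inequality.
\<close>

section \<open>Complex Hilbert spaces\<close>

lemma cinner_add_right:
  "cinner x (y + z) = cinner x y + cinner (x :: 'a::complex_hilbert_space) z"
  by (metis cinner_add_left cinner_commute complex_cnj_add)

lemma cinner_scaleC_right:
  "cinner x (c *\<^sub>C y) = cnj c * cinner (x :: 'a::complex_hilbert_space) y"
  by (metis cinner_commute cinner_scaleC_left complex_cnj_mult)

lemma cinner_minus_left: "cinner (- x) y = - cinner (x :: 'a::complex_hilbert_space) y"
  by (metis complex_vector.scale_minus_left scaleC_one cinner_scaleC_left mult_minus1)

lemma cinner_minus_right: "cinner x (- y) = - cinner (x :: 'a::complex_hilbert_space) y"
  by (metis cinner_minus_left cinner_commute complex_cnj_minus)

lemma cinner_zero_left: "cinner 0 y = 0"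
  by (metis cinner_add_left add_0 add_cancel_left_left)

lemma cinner_right_cancel:
  assumes "\<And>x. cinner x y = cinner x (z :: 'a::complex_hilbert_space)"
  shows "y = z"
proof -
  have "x \<bullet> y = x \<bullet> z" for x
    by (simp add: inner_eq_Re_cinner assms)
  then show ?thesis
    by (metis vector_eq_rdot inner_commute)
qed

text \<open>Together with \<open>scaleC_eq_scaleR\<close> this reduces complex coefficients to the
  real inner product, whose continuity is at hand; it serves the closedness argument in
  \<open>M_nonpos\<close>.\<close>

lemma Im_cinner: "Im (cinner x y) = ((- \<i>) *\<^sub>C x) \<bullet> (y :: 'a::complex_hilbert_space)"
  by (simp only: inner_eq_Re_cinner cinner_scaleC_left) simp

lemma scaleC_eq_scaleR: "c *\<^sub>C x = Re c *\<^sub>R x + Im c *\<^sub>R (\<i> *\<^sub>C (x :: 'a::complex_hilbert_space))"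
proof -
  have "complex_of_real (Re c) + complex_of_real (Im c) * \<i> = c"
    by (simp add: complex_eq_iff)
  then show ?thesis
    by (simp only: scaleR_scaleC scaleC_scaleC flip: scaleC_add_left)
qed

lemma norm_scaleC: "norm (c *\<^sub>C x) = cmod c * norm (x :: 'a::complex_hilbert_space)"
proof -
  have "(c *\<^sub>C x) \<bullet> (c *\<^sub>C x) = Re ((c * cnj c) * cinner x x)"
    by (simp add: inner_eq_Re_cinner cinner_scaleC_left cinner_scaleC_right algebra_simps)
  also have "\<dots> = (cmod c)\<^sup>2 * (x \<bullet> x)"
    unfolding complex_norm_square[symmetric] by (simp add: inner_eq_Re_cinner)
  finally show ?thesis
    by (simp add: norm_eq_sqrt_inner real_sqrt_mult)
qed

lemma bounded_linear_scaleC: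
  "bounded_linear (\<lambda>x :: 'a::complex_hilbert_space. c *\<^sub>C x)"
  by (rule bounded_linear_intro[where K = "cmod c"])
    (simp_all add: scaleC_add_right scaleR_scaleC scaleC_scaleC norm_scaleC mult.commute)

lemma bounded_clinear_add: "bounded_clinear T \<Longrightarrow> T (x + y) = T x + T y"
  and bounded_clinear_diff: "bounded_clinear T \<Longrightarrow> T (x - y) = T x - T y"
  and bounded_clinear_scaleC: "bounded_clinear T \<Longrightarrow> T (c *\<^sub>C x) = c *\<^sub>C T x"
  and bounded_clinear_minus: "bounded_clinear T \<Longrightarrow> T (- x) = - T x"
  and bounded_clinear_zero: "bounded_clinear T \<Longrightarrow> T 0 = 0"
  unfolding bounded_clinear_def
  by (auto simp: linear_simps dest: bounded_linear.linear linear_0)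

lemma bounded_clinear_comp:
  "bounded_clinear S \<Longrightarrow> bounded_clinear T \<Longrightarrow> bounded_clinear (S \<circ> T)"
  unfolding bounded_clinear_def by (auto simp: comp_def intro: bounded_linear_compose)

text \<open>The scalar product separates points, so for an everywhere defined operator
  \<open>THE\<close> picks the only possible \<open>z\<close>. Self-adjointness thus becomes
  symmetry, the form used from here on.\<close>

lemma bounded_self_adjoint_iff:
  "bounded_self_adjoint T \<longleftrightarrow>
    bounded_clinear T \<and> (\<forall>x y. cinner (T x) y = cinner x (T y))"
proof -
  have "op_adjoint (everywhere T) y = Some (T y) \<longleftrightarrow> (\<forall>x. cinner (T x) y = cinner x (T y))"
    for y
  proof
    assume *: "op_adjoint (everywhere T) y = Some (T y)"
    then obtain z where z: "\<forall>x. cinner (T x) y = cinner x z"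
      by (auto simp: op_adjoint_def dom_def split: if_splits)
    have "(THE z. \<forall>x. cinner (T x) y = cinner x z) = z"
      using z by (intro the_equality) (auto intro: cinner_right_cancel)
    with * z show "\<forall>x. cinner (T x) y = cinner x (T y)"
      by (auto simp: op_adjoint_def dom_def split: if_splits)
  next
    assume *: "\<forall>x. cinner (T x) y = cinner x (T y)"
    then have "(THE z. \<forall>x. cinner (T x) y = cinner x z) = T y"
      by (intro the_equality) (auto intro: cinner_right_cancel)
    with * show "op_adjoint (everywhere T) y = Some (T y)"
      by (auto simp: op_adjoint_def dom_def)
  qed
  then show ?thesis
    unfolding bounded_self_adjoint_def fun_eq_iff by auto
qed

section \<open>Lower bounds for boundedly invertible positive operators\<close>

text \<open>The core of the Cauchy--Schwarz inequality, kept free of any particular form: it serves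
  both the form of a positive operator and the negated Krein form on \<open>M\<close>.\<close>

lemma discriminant_le_0:
  fixes a b c :: real
  assumes "\<And>t. 0 \<le> a + 2 * t * b + t\<^sup>2 * c"
  shows "b\<^sup>2 \<le> a * c"
proof (cases "c = 0")
  case True
  have "b = 0"
  proof (rule ccontr)
    assume "b \<noteq> 0"
    \<comment> \<open>At this \<open>t\<close> the affine polynomial a + 2 t b takes the value
      -1.\<close>
    then have "2 * (- (a + 1) / (2 * b)) * b = - (a + 1)"
      by simp
    with assms[of "- (a + 1) / (2 * b)"] True show False
      by simp
  qed
  with True show ?thesis
    by simp
next
  case False
  have "0 \<le> a"
    using assms[of 0] by simp
  have "c > 0"
  proof (rule ccontr)
    assume "\<not> c > 0"
    with False have "c < 0" by simp
    \<comment> \<open>At both \<open>t\<close> and \<open>- t\<close> the constant and quadratic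
      terms add up to -1, while the linear terms have opposite signs; the two values cannot both be
      nonnegative.\<close>
    define t where "t = sqrt ((a + 1) / - c)"
    have "t\<^sup>2 = (a + 1) / - c"
      unfolding t_def using \<open>0 \<le> a\<close> \<open>c < 0\<close> by (simp add: divide_nonneg_neg)
    then have "t\<^sup>2 * c = - (a + 1)"
      using \<open>c < 0\<close> by (simp add: field_simps)
    with assms[of t] assms[of "- t"] show False
      by simp
  qed
  \<comment> \<open>The quadratic attains its minimum at \<open>- b / c\<close>.\<close>
  have "0 \<le> c * (a + 2 * (- b / c) * b + (- b / c)\<^sup>2 * c)"
    by (rule mult_nonneg_nonneg[OF less_imp_le[OF \<open>c > 0\<close>] assms])
  also have "\<dots> = a * c - b\<^sup>2"
    using \<open>c > 0\<close> by (simp add: field_simps power2_eq_square)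
  finally show ?thesis
    by simp
qed

text \<open>Cauchy--Schwarz for the form (T u, v) at u = x, v = T x gives ||T x||^4 <= (T x, x) (T T
  x, T x), and the last factor is at most K ||T x||^2. So (T x, x) dominates a multiple of ||T
  x||^2, which the bounded left inverse \<open>S\<close> turns into a multiple of ||x||^2.\<close>

lemma positive_operator_bounded_below:
  assumes T: "positive_operator T" and S: "bounded_clinear S" "\<And>x. S (T x) = x"
  shows "\<exists>\<alpha>>0. \<forall>x. Re (cinner (T x) x) \<ge> \<alpha> * (norm x)\<^sup>2"
proof -
  have lin: "bounded_clinear T" and sa: "cinner (T x) y = cinner x (T y)" for x y
    using T by (auto simp: positive_operator_def bounded_self_adjoint_iff)
  have sa': "T x \<bullet> y = x \<bullet> T y" for x y
    by (simp add: inner_eq_Re_cinner sa)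
  have nonneg: "T x \<bullet> x \<ge> 0" for x
    using T
    by (cases "x = 0") (auto simp: positive_operator_def inner_eq_Re_cinner less_imp_le
        bounded_clinear_zero[OF lin] cinner_zero_left)
  have "bounded_linear T" "bounded_linear S"
    using lin S by (auto simp: bounded_clinear_def)
  then obtain K k where K: "K > 0" "\<And>x. norm (T x) \<le> norm x * K"
    and k: "k > 0" "\<And>x. norm (S x) \<le> norm x * k"
    by (meson bounded_linear.pos_bounded)
  \<comment> \<open>The constant combines ||x||^2 <= k^2 ||T x||^2 with ||T x||^2 <= K (T x,
    x).\<close>
  have "T x \<bullet> x \<ge> (1 / (K * k\<^sup>2)) * (norm x)\<^sup>2" for x
  proof (cases "x = 0")
    case False
    then have Tx: "norm (T x) > 0"
      using S(2)[of x] bounded_clinear_zero[OF S(1)] by auto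
    have "(T x \<bullet> T x)\<^sup>2 \<le> (T x \<bullet> x) * (T (T x) \<bullet> T x)"
    proof (rule discriminant_le_0)
      fix t
      have "0 \<le> T (x + t *\<^sub>R T x) \<bullet> (x + t *\<^sub>R T x)"
        by (rule nonneg)
      also have "\<dots> = T x \<bullet> x + 2 * t * (T x \<bullet> T x) + t\<^sup>2 * (T (T x) \<bullet> T x)"
        using lin
        by (simp add: bounded_clinear_add scaleR_scaleC bounded_clinear_scaleC)
          (simp add: scaleR_scaleC[symmetric] inner_simps sa' power2_eq_square algebra_simps)
      finally show "0 \<le> T x \<bullet> x + 2 * t * (T x \<bullet> T x) + t\<^sup>2 * (T (T x) \<bullet> T x)" .
    qed
    also have "\<dots> \<le> (T x \<bullet> x) * (K * (norm (T x))\<^sup>2)"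
    proof (rule mult_left_mono[OF _ nonneg])
      have "T (T x) \<bullet> T x \<le> norm (T (T x)) * norm (T x)"
        by (rule norm_cauchy_schwarz)
      also have "\<dots> \<le> norm (T x) * K * norm (T x)"
        by (rule mult_right_mono[OF K(2)]) simp
      finally show "T (T x) \<bullet> T x \<le> K * (norm (T x))\<^sup>2"
        by (simp add: power2_eq_square mult_ac)
    qed
    finally have "(norm (T x))\<^sup>2 * (norm (T x))\<^sup>2 \<le> (T x \<bullet> x * K) * (norm (T x))\<^sup>2"
      by (simp add: power2_norm_eq_inner power2_eq_square[of "T x \<bullet> T x"] mult_ac)
    then have *: "(norm (T x))\<^sup>2 \<le> T x \<bullet> x * K"
      by (rule mult_right_le_imp_le) (use Tx in simp)
    have "(norm x)\<^sup>2 \<le> (norm (T x) * k)\<^sup>2"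
      using k(2)[of "T x"] S(2) by (intro power_mono) auto
    also have "\<dots> \<le> (T x \<bullet> x * K) * k\<^sup>2"
      unfolding power_mult_distrib by (rule mult_right_mono[OF *]) simp
    finally show ?thesis
      using K k by (simp add: field_simps)
  qed (simp add: nonneg)
  moreover have "1 / (K * k\<^sup>2) > 0"
    using K k by simp
  ultimately show ?thesis
    by (metis inner_eq_Re_cinner)
qed


section \<open>Involutions and direct sums\<close>

lemma direct_sum_unique:
  assumes "direct_sum S L M" "csubspace L" "csubspace M"
    and "a \<in> L" "a' \<in> L" "b \<in> M" "b' \<in> M" "a + b = a' + b'"
  shows "a = a'" "b = b'"
proof -
  have "a - a' \<in> L" "b' - b \<in> M"
    using assms complex_vector.subspace_diff by blast+
  moreover have "a - a' = b' - b"
    using assms(8) by (simp add: algebra_simps)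
  ultimately have "a - a' \<in> L \<inter> M"
    by simp
  then show "a = a'"
    using assms(1) unfolding direct_sum_def by auto
  with assms(8) show "b = b'"
    by simp
qed

lemma direct_sum_projection:
  assumes "direct_sum UNIV L M" "csubspace L" "csubspace M"
  obtains P where "\<And>z. P z \<in> L" "\<And>z. z - P z \<in> M"
    "\<And>a b. a \<in> L \<Longrightarrow> b \<in> M \<Longrightarrow> P (a + b) = a"
proof -
  have "\<exists>a. a \<in> L \<and> z - a \<in> M" for z
  proof -
    have "z \<in> {x + y |x y. x \<in> L \<and> y \<in> M}"
      using assms(1) unfolding direct_sum_def by blast
    then show ?thesis by auto
  qed
  then obtain P where P: "\<And>z. P z \<in> L" "\<And>z. z - P z \<in> M"
    by metis
  moreover have "P (a + b) = a" if "a \<in> L" "b \<in> M" for a b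
    by (rule direct_sum_unique(1)[OF assms, where b = "a + b - P (a + b)" and b' = b])
      (use P that in auto)
  ultimately show ?thesis
    by (rule that)
qed

section \<open>Commuting with an involution and decomposing along its eigenspaces\<close>

text \<open>Invariance of \<open>dom A\<close> under \<open>C\<close> already gives equality of the
  two natural domains: if \<open>C x\<close> lies in \<open>dom A\<close>, so does
  \<open>C (C x) = x\<close>.\<close>

lemma dom_commutes_iff:
  assumes "C \<circ> C = id"
  shows "A \<circ>\<^sub>m everywhere C = everywhere C \<circ>\<^sub>m A \<longleftrightarrow>
    (\<forall>x\<in>dom A. C x \<in> dom A \<and> the (A (C x)) = C (the (A x)))"
proof -
  have CC: "C (C x) = x" for x
    using assms by (simp add: fun_eq_iff)
  have "A \<circ>\<^sub>m everywhere C = everywhere C \<circ>\<^sub>m A \<longleftrightarrow> (\<forall>x. A (C x) = map_option C (A x))"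
    unfolding fun_eq_iff map_comp_def map_option_case by (simp add: o_def split: option.split)
  also have "\<dots> \<longleftrightarrow> (\<forall>x\<in>dom A. C x \<in> dom A \<and> the (A (C x)) = C (the (A x)))"
  proof (intro iffI allI)
    fix x
    assume *: "\<forall>x\<in>dom A. C x \<in> dom A \<and> the (A (C x)) = C (the (A x))"
    show "A (C x) = map_option C (A x)"
    proof (cases "x \<in> dom A")
      case True
      then have "C x \<in> dom A" "the (A (C x)) = C (the (A x))"
        using * by blast+
      with True show ?thesis by auto
    next
      case False
      moreover have "C x \<notin> dom A"
        using * CC False by metis
      ultimately show ?thesis by (auto simp: domIff)
    qed
  qed (auto simp: domIff)
  finally show ?thesis .
qed

lemma ran_restrict_subset_iff: "ran (A |` M) \<subseteq> N \<longleftrightarrow> (\<forall>x\<in>dom A \<inter> M. the (A x) \<in> N)"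
proof
  show "ran (A |` M) \<subseteq> N \<Longrightarrow> \<forall>x\<in>dom A \<inter> M. the (A x) \<in> N"
    by (force simp: ran_def restrict_map_def subset_iff)
  show "\<forall>x\<in>dom A \<inter> M. the (A x) \<in> N \<Longrightarrow> ran (A |` M) \<subseteq> N"
    by (force simp: ran_def restrict_map_def split: if_splits)
qed

text \<open>Split x into (x + C x)/2 and (x - C x)/2. Both halves stay in \<open>dom A\<close>,
  because this subspace is invariant under \<open>C\<close>, and \<open>A\<close> maps each
  eigenspace into itself by commutation.\<close>

lemma commutes_imp_decomposes:
  assumes C: "bounded_clinear C" "C \<circ> C = id" and A: "linear_operator A"
    and comm: "A \<circ>\<^sub>m everywhere C = everywhere C \<circ>\<^sub>m A"
  shows "decomposes A {x. C x = x} {x. C x = - x}"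
proof -
  have CC: "C (C x) = x" for x
    using C(2) by (simp add: fun_eq_iff)
  have dom: "C x \<in> dom A" and AC: "the (A (C x)) = C (the (A x))" if "x \<in> dom A" for x
    using comm that by (auto simp: dom_commutes_iff[OF C(2)])
  have scale: "the (A (c *\<^sub>C x)) = c *\<^sub>C the (A x)" if "x \<in> dom A" for c x
    using A that by (auto simp: linear_operator_def)
  have sub: "csubspace (dom A)"
    using A by (auto simp: linear_operator_def)
  have neg: "the (A (- x)) = - the (A x)" if "x \<in> dom A" for x
    using scale[OF that, of "-1"] by (simp add: scaleC_one)
  have half: "(1/2) *\<^sub>C (x + C x) + (1/2) *\<^sub>C (x - C x) = x" for x
  proof -
    have "(1/2) *\<^sub>C (x + C x) + (1/2) *\<^sub>C (x - C x) = (1/2 + 1/2) *\<^sub>C x"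
      by (simp only: scaleC_add_right complex_vector.scale_right_diff_distrib scaleC_add_left) simp
    then show ?thesis by (simp add: scaleC_one)
  qed
  have disjoint: "x = 0" if "C x = x" "C x = - x" for x
  proof -
    have "x + x = 0"
      using that by (metis right_minus)
    then show ?thesis
      by (simp flip: scaleR_2)
  qed
  have "direct_sum (dom A) (dom A \<inter> {x. C x = x}) (dom A \<inter> {x. C x = - x})"
    unfolding direct_sum_def
  proof (intro conjI subset_antisym subsetI)
    fix x assume x: "x \<in> dom A"
    let ?a = "(1/2) *\<^sub>C (x + C x)" and ?b = "(1/2) *\<^sub>C (x - C x)"
    have "C ?a = ?a"
      by (simp only: bounded_clinear_scaleC[OF C(1)] bounded_clinear_add[OF C(1)] CC add.commute)
    moreover have "C ?b = - ?b"
      by (simp only: bounded_clinear_scaleC[OF C(1)] bounded_clinear_diff[OF C(1)] CC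
          minus_diff_eq flip: complex_vector.scale_minus_right)
    moreover have "?a \<in> dom A"
      by (intro complex_vector.subspace_scale complex_vector.subspace_add sub x dom)
    moreover have "?b \<in> dom A"
      by (intro complex_vector.subspace_scale complex_vector.subspace_diff sub x dom)
    ultimately show "x \<in> {x + y |x y. x \<in> dom A \<inter> {x. C x = x} \<and> y \<in> dom A \<inter> {x. C x = - x}}"
      using half[of x, symmetric] by blast
  next
    fix x assume "x \<in> {x + y |x y. x \<in> dom A \<inter> {x. C x = x} \<and> y \<in> dom A \<inter> {x. C x = - x}}"
    then show "x \<in> dom A"
      using complex_vector.subspace_add[OF sub] by blast
  next
    fix x assume "x \<in> dom A \<inter> {x. C x = x} \<inter> (dom A \<inter> {x. C x = - x})"
    then show "x \<in> {0}"
      using disjoint by blast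
  next
    fix x :: 'a assume "x \<in> {0}"
    then show "x \<in> dom A \<inter> {x. C x = x} \<inter> (dom A \<inter> {x. C x = - x})"
      using complex_vector.subspace_0[OF sub] bounded_clinear_zero[OF C(1)] by simp
  qed
  moreover have "C (the (A x)) = the (A x)" if "x \<in> dom A" "C x = x" for x
    using AC[OF that(1)] that(2) by simp
  moreover have "C (the (A x)) = - the (A x)" if "x \<in> dom A" "C x = - x" for x
    using AC[OF that(1)] that(2) neg[OF that(1)] by simp
  ultimately show ?thesis
    unfolding decomposes_def ran_restrict_subset_iff by blast
qed

text \<open>A vector of the domain splits inside the domain, and \<open>A\<close> acts on the two
  components separately; changing the sign of the second component can therefore be done before or
  after \<open>A\<close>.\<close>

lemma decomposes_imp_commutes:
  assumes A: "linear_operator A" and dec: "decomposes A L M" and CC: "C \<circ> C = id"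
    and C: "\<And>a b. a \<in> L \<Longrightarrow> b \<in> M \<Longrightarrow> C (a + b) = a - b"
  shows "A \<circ>\<^sub>m everywhere C = everywhere C \<circ>\<^sub>m A"
  unfolding dom_commutes_iff[OF CC]
proof
  fix x assume "x \<in> dom A"
  have sub: "csubspace (dom A)"
    using A by (simp add: linear_operator_def)
  have add: "the (A (x + y)) = the (A x) + the (A y)" if "x \<in> dom A" "y \<in> dom A" for x y
    using A that by (simp add: linear_operator_def)
  have "x \<in> {a + b |a b. a \<in> dom A \<inter> L \<and> b \<in> dom A \<inter> M}"
    using dec \<open>x \<in> dom A\<close> unfolding decomposes_def direct_sum_def by blast
  then obtain a b where x: "x = a + b" and a: "a \<in> dom A" "a \<in> L" and b: "b \<in> dom A" "b \<in> M"
    by auto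
  have AL: "the (A a) \<in> L" and AM: "the (A b) \<in> M"
    using dec a b by (auto simp: decomposes_def ran_restrict_subset_iff)
  have Cx: "C x = a - b"
    using x a b C by simp
  then have "C x \<in> dom A"
    using a b sub by (simp add: complex_vector.subspace_diff)
  \<comment> \<open>Additivity on (a - b) + b = a yields the value of \<open>A\<close> at a -
    b.\<close>
  moreover have "the (A (C x)) = the (A a) - the (A b)"
    using add[of "a - b" b] a b sub unfolding Cx by (simp add: complex_vector.subspace_diff)
  moreover have "C (the (A x)) = the (A a) - the (A b)"
    using add a b C AL AM unfolding x by simp
  ultimately show "C x \<in> dom A \<and> the (A (C x)) = C (the (A x))"
    by simp
qed


section \<open>Krein spaces\<close>

locale krein_space =
  fixes J :: "'a::complex_hilbert_space \<Rightarrow> 'a"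
  assumes fundamental_symmetry: "fundamental_symmetry J"
begin

abbreviation krein
  where "krein x y \<equiv> krein_inner J x y"

lemma J_J: "J (J x) = x"
  using fundamental_symmetry by (simp add: fundamental_symmetry_def fun_eq_iff)

lemma bounded_clinear_J: "bounded_clinear J"
  using fundamental_symmetry by (simp add: fundamental_symmetry_def bounded_self_adjoint_iff)

lemma cinner_J: "cinner (J x) y = cinner x (J y)"
  using fundamental_symmetry by (simp add: fundamental_symmetry_def bounded_self_adjoint_iff)

lemma krein_commute: "krein x y = cnj (krein y x)"
  unfolding krein_inner_def by (metis cinner_J cinner_commute)

lemma krein_add_left: "krein (x + y) z = krein x z + krein y z"
  by (simp add: krein_inner_def bounded_clinear_add[OF bounded_clinear_J] cinner_add_left)

lemma krein_zero_left: "krein 0 z = 0"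
  by (simp add: krein_inner_def bounded_clinear_zero[OF bounded_clinear_J] cinner_zero_left)

lemma krein_add_right: "krein x (y + z) = krein x y + krein x z"
  by (simp add: krein_inner_def cinner_add_right)

lemma krein_minus_left: "krein (- x) y = - krein x y"
  by (simp add: krein_inner_def bounded_clinear_minus[OF bounded_clinear_J] cinner_minus_left)

lemma krein_minus_right: "krein x (- y) = - krein x y"
  by (simp add: krein_inner_def cinner_minus_right)

lemma krein_diff_left: "krein (x - y) z = krein x z - krein y z"
  using krein_add_left[of x "- y" z] by (simp add: krein_minus_left)

lemma krein_diff_right: "krein x (y - z) = krein x y - krein x z"
  using krein_add_right[of x y "- z"] by (simp add: krein_minus_right)

lemma krein_scaleC_left: "krein (c *\<^sub>C x) y = c * krein x y"
  by (simp add: krein_inner_def bounded_clinear_scaleC[OF bounded_clinear_J] cinner_scaleC_left)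

lemma krein_scaleC_right: "krein x (c *\<^sub>C y) = cnj c * krein x y"
  by (simp add: krein_inner_def cinner_scaleC_right)

lemmas krein_simps = krein_add_left krein_add_right krein_minus_left krein_minus_right
  krein_diff_left krein_diff_right krein_scaleC_left krein_scaleC_right

lemma norm_J: "norm (J x) = norm x"
proof -
  have "J x \<bullet> J x = x \<bullet> x"
    by (simp add: inner_eq_Re_cinner cinner_J J_J)
  then show ?thesis
    by (simp add: norm_eq_sqrt_inner)
qed

lemma Re_krein_le: "Re (krein x y) \<le> norm x * norm y"
  using norm_cauchy_schwarz[of "J x" y]
  by (simp add: krein_inner_def norm_J inner_eq_Re_cinner)

text \<open>Testing with y = J x gives ||J x||^2 = 0, so real parts are enough.\<close>

lemma krein_nondegenerate:
  assumes "\<And>y. Re (krein x y) = 0"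
  shows "x = 0"
proof -
  have "J x \<bullet> J x = 0"
    using assms[of "J x"] by (simp add: krein_inner_def inner_eq_Re_cinner)
  then show ?thesis
    by (metis norm_J inner_eq_zero_iff norm_eq_zero)
qed

lemma csubspace_krein_complement: "csubspace (krein_complement J L)"
  by (rule complex_vector.subspaceI)
    (auto simp: krein_complement_def krein_simps krein_zero_left)

section \<open>From an operator C to a maximal uniformly positive subspace\<close>

text \<open>[x, x] equals (J C x, x) on \<open>L\<close> and its negative on \<open>M\<close>, so a
  single lower bound for J C controls the form on both eigenspaces.\<close>

lemma C_symmetry_imp_splitting:
  assumes C: "bounded_clinear C" "C \<circ> C = id" and pos: "positive_operator (J \<circ> C)"
  defines "L \<equiv> {x. C x = x}" and "M \<equiv> {x. C x = - x}"
  shows "maximal_uniformly_positive J L" "krein_complement J L = M"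
    "krein_direct_sum J UNIV L M"
proof -
  have CC: "C (C x) = x" for x
    using C(2) by (simp add: fun_eq_iff)
  note C_simps = bounded_clinear_add[OF C(1)] bounded_clinear_diff[OF C(1)]
    bounded_clinear_scaleC[OF C(1)] bounded_clinear_zero[OF C(1)] CC
  \<comment> \<open>Since \<open>J\<close> and \<open>C\<close> are involutions,
    \<open>C \<circ> J\<close> is the bounded left inverse of \<open>J \<circ> C\<close> required
    here.\<close>
  obtain \<alpha> where \<alpha>: "\<alpha> > 0" "\<And>x. Re (cinner (J (C x)) x) \<ge> \<alpha> * (norm x)\<^sup>2"
    using positive_operator_bounded_below[OF pos bounded_clinear_comp[OF C(1) bounded_clinear_J]]
    by (auto simp: J_J CC)
  have sa: "cinner (J (C x)) y = cinner x (J (C y))" for x y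
    using pos by (simp add: positive_operator_def bounded_self_adjoint_iff)
  have posL: "Re (krein x x) \<ge> \<alpha> * (norm x)\<^sup>2" if "x \<in> L" for x
    using \<alpha>(2)[of x] that by (simp add: L_def krein_inner_def)
  have negM: "Re (krein x x) \<le> - \<alpha> * (norm x)\<^sup>2" if "x \<in> M" for x
    using \<alpha>(2)[of x] that
    by (simp add: M_def krein_inner_def bounded_clinear_minus[OF bounded_clinear_J] cinner_minus_left)
  have orth: "krein x y = 0" if "x \<in> L" "y \<in> M" for x y
  proof -
    \<comment> \<open>J C is moved across the scalar product: \<open>C\<close> fixes x and reverses
      the sign of y.\<close>
    have "krein x y = - krein x y"
      using sa[of x y] that
      by (simp add: L_def M_def krein_inner_def bounded_clinear_minus[OF bounded_clinear_J]
          cinner_minus_right cinner_J)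
    then show ?thesis by simp
  qed
  have cont_C: "continuous_on UNIV C"
    using C(1) by (simp add: bounded_clinear_def linear_continuous_on)
  have L: "closed_csubspace L"
    unfolding closed_csubspace_def L_def
    by (auto intro!: complex_vector.subspaceI closed_Collect_eq cont_C continuous_on_id simp: C_simps)
  \<comment> \<open>The witnesses are (I + C)/2 and (I - C)/2, the projections onto the two
    eigenspaces.\<close>
  obtain P Q where split: "\<And>z. z = P z + Q z" "\<And>z. P z \<in> L" "\<And>z. Q z \<in> M"
  proof
    fix z
    have "(1/2) *\<^sub>C (z + C z) + (1/2) *\<^sub>C (z - C z) = (1/2 + 1/2) *\<^sub>C z"
      by (simp only: scaleC_add_right complex_vector.scale_right_diff_distrib scaleC_add_left) simp
    then show "z = (1/2) *\<^sub>C (z + C z) + (1/2) *\<^sub>C (z - C z)"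
      by (simp add: scaleC_one)
    show "(1/2) *\<^sub>C (z + C z) \<in> L" "(1/2) *\<^sub>C (z - C z) \<in> M"
      by (simp_all add: L_def M_def C_simps add.commute complex_vector.scale_right_diff_distrib)
  qed
  have "x = 0" if "x \<in> L" "x \<in> M" for x
    using posL[OF that(1)] negM[OF that(2)] \<alpha>(1) by (smt (verit) mult_pos_pos zero_less_norm_iff zero_less_power mult_minus_left)
  moreover have "0 \<in> L" "0 \<in> M"
    by (simp_all add: L_def M_def C_simps)
  ultimately show "krein_direct_sum J UNIV L M"
    unfolding krein_direct_sum_def direct_sum_def using orth split by blast
  show "krein_complement J L = M"
  proof (intro set_eqI iffI)
    fix z assume "z \<in> M"
    then show "z \<in> krein_complement J L"
      using orth by (auto simp: krein_complement_def) (metis krein_commute complex_cnj_zero)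
  next
    fix z assume "z \<in> krein_complement J L"
    \<comment> \<open>Testing z against its own component in \<open>L\<close> gives 0 = [z, P z] =
      [P z, P z], and uniform positivity then forces P z = 0.\<close>
    then have "krein z (P z) = 0"
      using split by (simp add: krein_complement_def)
    moreover have "krein (Q z) (P z) = 0"
      using orth split by (metis krein_commute complex_cnj_zero)
    ultimately have "krein (P z) (P z) = 0"
      by (metis split(1) krein_add_left add.right_neutral)
    then have "\<alpha> * (norm (P z))\<^sup>2 \<le> 0"
      using posL[OF split(2), of z] by simp
    then have "P z = 0"
      using \<alpha>(1) by (simp add: mult_le_0_iff)
    then show "z \<in> M"
      by (metis split(1,3) add_0)
  qed
  show "maximal_uniformly_positive J L"
    unfolding maximal_uniformly_positive_def
  proof (intro conjI notI)
    show "uniformly_positive J L"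
      using L posL \<alpha>(1) by (auto simp: uniformly_positive_def)
  next
    assume "\<exists>N. uniformly_positive J N \<and> L \<subset> N"
    then obtain N \<beta> z where N: "csubspace N" "L \<subseteq> N" "z \<in> N" "z \<notin> L"
      and \<beta>: "\<beta> > 0" "\<And>x. x \<in> N \<Longrightarrow> Re (krein x x) \<ge> \<beta> * (norm x)\<^sup>2"
      unfolding uniformly_positive_def closed_csubspace_def by blast
    \<comment> \<open>As \<open>N\<close> contains \<open>L\<close>, it also contains Q z, which
      lies in \<open>M\<close>. The form at Q z is bounded below through \<open>N\<close> and above
      through \<open>M\<close>, so Q z = 0 and z would belong to \<open>L\<close>.\<close>
    have "Q z = z - P z"
      using split(1)[of z] by (metis add_diff_cancel_left')
    then have "Q z \<in> N"
      using N split by (auto intro: complex_vector.subspace_diff)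
    then have "\<beta> * (norm (Q z))\<^sup>2 \<le> - \<alpha> * (norm (Q z))\<^sup>2"
      using \<beta>(2) negM[OF split(3)] by (meson order_trans)
    then have "(\<beta> + \<alpha>) * (norm (Q z))\<^sup>2 \<le> 0"
      by (simp add: algebra_simps)
    then have "Q z = 0"
      using \<alpha>(1) \<beta>(1) by (simp add: mult_le_0_iff)
    with \<open>z \<notin> L\<close> show False
      by (metis split(1,2) add.right_neutral)
  qed
qed

end

section \<open>From a maximal uniformly positive subspace to an operator C\<close>

text \<open>The setting of the converse: \<open>P\<close> is the projection onto \<open>L\<close>
  along \<open>M\<close>, and \<open>\<alpha>\<close> is a constant of uniform positivity for
  \<open>L\<close>.\<close>

locale maximal_splitting = krein_space J
  for J :: "'a::complex_hilbert_space \<Rightarrow> 'a" +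
  fixes L M :: "'a set" and P :: "'a \<Rightarrow> 'a" and \<alpha> :: real
  assumes maximal: "maximal_uniformly_positive J L"
    and splitting: "krein_direct_sum J UNIV L M"
    and subspace_L: "csubspace L" and subspace_M: "csubspace M"
    and P_in: "P z \<in> L" and Q_in: "z - P z \<in> M"
    and P_add: "a \<in> L \<Longrightarrow> b \<in> M \<Longrightarrow> P (a + b) = a"
    and \<alpha>_pos: "\<alpha> > 0"
    and \<alpha>_le: "x \<in> L \<Longrightarrow> \<alpha> * (norm x)\<^sup>2 \<le> Re (krein_inner J x x)"
begin

lemma orth: "a \<in> L \<Longrightarrow> b \<in> M \<Longrightarrow> krein a b = 0"
  using splitting by (simp add: krein_direct_sum_def)

lemma orth': "a \<in> L \<Longrightarrow> b \<in> M \<Longrightarrow> krein b a = 0"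
  by (metis krein_commute complex_cnj_zero orth)

text \<open>Linearity comes from uniqueness of the splitting. For the bound, \<alpha> ||P x||^2 <=
  [P x, P x] = [x, P x] <= ||x|| ||P x||, where the equality holds because x - P x is
  Krein-orthogonal to \<open>L\<close>.\<close>

lemma bounded_clinear_P: "bounded_clinear P"
proof -
  have add: "P (x + y) = P x + P y" for x y
    using P_add[of "P x + P y" "(x - P x) + (y - P y)"] P_in Q_in subspace_L subspace_M
    by (simp add: complex_vector.subspace_add)
  have scale: "P (c *\<^sub>C x) = c *\<^sub>C P x" for c x
    using P_add[of "c *\<^sub>C P x" "c *\<^sub>C (x - P x)"] P_in Q_in subspace_L subspace_M
    by (simp add: complex_vector.subspace_scale flip: scaleC_add_right)
  have "norm (P x) \<le> norm x * (1 / \<alpha>)" for x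
  proof (cases "P x = 0")
    case False
    have "\<alpha> * (norm (P x))\<^sup>2 \<le> Re (krein (P x) (P x))"
      by (rule \<alpha>_le[OF P_in])
    also have "\<dots> = Re (krein x (P x))"
      using orth'[OF P_in Q_in, of x x] by (simp add: krein_diff_left)
    also have "\<dots> \<le> norm x * norm (P x)"
      by (rule Re_krein_le)
    finally show ?thesis
      using False \<alpha>_pos by (simp add: power2_eq_square field_simps)
  qed (use \<alpha>_pos in simp)
  then have "bounded_linear P"
    by (intro bounded_linear_intro[where K = "1 / \<alpha>"]) (simp_all add: add scale scaleR_scaleC)
  then show ?thesis
    by (simp add: bounded_clinear_def scale)
qed

text \<open>If [b, b] > 0, then \<open>L\<close> together with the line through b is still uniformly
  positive: the two summands are Krein-orthogonal and the form is bounded below on each. This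
  contradicts maximality, as b is not in \<open>L\<close>.\<close>

lemma M_nonpos:
  assumes b: "b \<in> M"
  shows "Re (krein b b) \<le> 0"
proof (rule ccontr)
  assume "\<not> Re (krein b b) \<le> 0"
  then have pos: "Re (krein b b) > 0" by simp
  then have "b \<noteq> 0"
    by (auto simp: krein_zero_left)
  define Q where "Q z = z - P z" for z
  define f where "f z = inverse ((norm b)\<^sup>2) *\<^sub>R (cinner (Q z) b *\<^sub>C b)" for z
  \<comment> \<open>\<open>f z\<close> is the orthogonal projection of \<open>Q z\<close> onto the line through \<open>b\<close>, so \<open>N\<close> is the sum of \<open>L\<close> and
    this line, written as a set that is visibly closed.\<close>
  define N where "N = {z. Q z = f z}"
  have linP: "bounded_linear P" and P_scale: "P (c *\<^sub>C z) = c *\<^sub>C P z" for c z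
    using bounded_clinear_P by (auto simp: bounded_clinear_def)
  have Q: "bounded_linear Q"
    unfolding Q_def by (intro bounded_linear_sub bounded_linear_ident linP)
  have Q_add: "Q (x + y) = Q x + Q y" and Q_scale: "Q (c *\<^sub>C x) = c *\<^sub>C Q x" and Q_zero: "Q 0 = 0"
    for c x y
    by (simp_all add: Q_def P_scale linear_simps[OF linP] complex_vector.scale_right_diff_distrib)
  \<comment> \<open>In terms of real inner products \<open>f\<close> is visibly continuous.\<close>
  have f_eq: "f z = inverse ((norm b)\<^sup>2) *\<^sub>R
      ((Q z \<bullet> b) *\<^sub>R b + (((- \<i>) *\<^sub>C Q z) \<bullet> b) *\<^sub>R (\<i> *\<^sub>C b))" for z
    by (simp only: f_def scaleC_eq_scaleR[of "cinner (Q z) b"] inner_eq_Re_cinner Im_cinner)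
  have contQ: "continuous_on UNIV Q"
    by (rule linear_continuous_on[OF Q])
  have "continuous_on UNIV f"
    unfolding f_eq
    by (intro continuous_intros contQ bounded_linear.continuous_on[OF bounded_linear_scaleC])
  with contQ have "closed N"
    unfolding N_def by (rule closed_Collect_eq)
  moreover have "csubspace N"
  proof -
    have "f (x + y) = f x + f y" for x y
      by (simp only: f_def Q_add cinner_add_left scaleC_add_left scaleR_add_right)
    moreover have "f (c *\<^sub>C x) = c *\<^sub>C f x" for c x
      by (simp only: f_def Q_scale cinner_scaleC_left scaleR_scaleC scaleC_scaleC mult_ac)
    moreover have "f 0 = 0"
      by (simp add: f_def Q_zero cinner_zero_left)
    ultimately show ?thesis
      unfolding N_def by (intro complex_vector.subspaceI) (simp_all add: Q_add Q_scale Q_zero)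
  qed
  ultimately have "closed_csubspace N"
    by (simp add: closed_csubspace_def)
  \<comment> \<open>On the line through b, the Krein form is exactly \<open>\<beta>\<close> times
    the squared norm, since both scale with the squared modulus of the coefficient.\<close>
  moreover define \<beta> where "\<beta> = Re (krein b b) / (norm b)\<^sup>2"
  then have "\<beta> > 0"
    using pos \<open>b \<noteq> 0\<close> by simp
  \<comment> \<open>The factor 1/2 pays for ||z||^2 <= 2 (||P z||^2 + ||Q z||^2); the cross terms of
    [z, z] vanish by Krein-orthogonality.\<close>
  have "min \<alpha> \<beta> / 2 * (norm z)\<^sup>2 \<le> Re (krein z z)" if "z \<in> N" for z
  proof -
    define c where "c = complex_of_real (inverse ((norm b)\<^sup>2)) * cinner (Q z) b"
    have Qz: "Q z = c *\<^sub>C b"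
      using that by (simp add: N_def f_def c_def scaleR_scaleC scaleC_scaleC)
    have "krein (Q z) (Q z) = (c * cnj c) * krein b b"
      by (simp add: Qz krein_simps)
    then have krQ: "Re (krein (Q z) (Q z)) = (cmod c)\<^sup>2 * Re (krein b b)"
      unfolding complex_norm_square[symmetric] by simp
    have "(norm (Q z))\<^sup>2 = (cmod c)\<^sup>2 * (norm b)\<^sup>2"
      by (simp add: Qz norm_scaleC power_mult_distrib)
    then have Q_eq: "Re (krein (Q z) (Q z)) = \<beta> * (norm (Q z))\<^sup>2"
      using \<open>b \<noteq> 0\<close> by (simp add: krQ \<beta>_def)
    have z: "z = P z + Q z" and QM: "Q z \<in> M"
      by (simp_all add: Q_def Q_in)
    have "(norm z)\<^sup>2 \<le> (norm (P z) + norm (Q z))\<^sup>2"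
      by (metis z norm_triangle_ineq norm_ge_zero power_mono)
    also have "\<dots> \<le> 2 * ((norm (P z))\<^sup>2 + (norm (Q z))\<^sup>2)"
      using sum_squares_bound[of "norm (P z)" "norm (Q z)"] by (simp add: power2_sum)
    finally have "min \<alpha> \<beta> / 2 * (norm z)\<^sup>2 \<le> min \<alpha> \<beta> / 2 * (2 * ((norm (P z))\<^sup>2 + (norm (Q z))\<^sup>2))"
      using \<alpha>_pos \<open>\<beta> > 0\<close> by (intro mult_left_mono) auto
    also have "\<dots> = min \<alpha> \<beta> * (norm (P z))\<^sup>2 + min \<alpha> \<beta> * (norm (Q z))\<^sup>2"
      by (simp add: algebra_simps)
    also have "\<dots> \<le> \<alpha> * (norm (P z))\<^sup>2 + \<beta> * (norm (Q z))\<^sup>2"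
      by (intro add_mono mult_right_mono) auto
    also have "\<dots> \<le> Re (krein (P z) (P z)) + Re (krein (Q z) (Q z))"
      using \<alpha>_le[OF P_in] by (simp add: Q_eq)
    also have "\<dots> = Re (krein (P z + Q z) (P z + Q z))"
      using orth[OF P_in QM] orth'[OF P_in QM] by (simp add: krein_simps)
    finally show ?thesis
      using z by simp
  qed
  moreover have "min \<alpha> \<beta> / 2 > 0"
    using \<alpha>_pos \<open>\<beta> > 0\<close> by simp
  ultimately have "uniformly_positive J N"
    unfolding uniformly_positive_def by blast
  moreover have "L \<subseteq> N"
  proof
    fix a assume "a \<in> L"
    then have "P a = a"
      using P_add[of a 0] complex_vector.subspace_0[OF subspace_M] by simp
    then have "Q a = 0"
      by (simp add: Q_def)
    then show "a \<in> N"
      by (simp add: N_def f_eq)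
  qed
  moreover have "b \<in> N"
  proof -
    have "P b = 0"
      using P_add[of 0 b] b complex_vector.subspace_0[OF subspace_L] by simp
    then have Qb: "Q b = b"
      by (simp add: Q_def)
    \<comment> \<open>(b, b) is real and equals ||b||^2, so it cancels the normalizing factor in
      \<open>f\<close>.\<close>
    have "Im (cinner b b) = 0"
      using cinner_commute[of b b] by (metis cnj.sel(2) neg_equal_zero)
    then have "cinner b b = complex_of_real ((norm b)\<^sup>2)"
      by (simp add: complex_eq_iff power2_norm_eq_inner inner_eq_Re_cinner)
    then have "cinner b b *\<^sub>C b = (norm b)\<^sup>2 *\<^sub>R b"
      by (simp only: scaleR_scaleC)
    then have "f b = b"
      using \<open>b \<noteq> 0\<close> by (simp add: f_def Qb)
    then show ?thesis
      by (simp add: N_def Qb)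
  qed
  moreover have "b \<notin> L"
    using splitting b \<open>b \<noteq> 0\<close> by (auto simp: krein_direct_sum_def direct_sum_def)
  ultimately show False
    using maximal unfolding maximal_uniformly_positive_def by blast
qed

text \<open>By \<open>M_nonpos\<close> the negated form is positive semidefinite on
  \<open>M\<close>, so Cauchy--Schwarz makes a neutral b orthogonal to \<open>M\<close> in real
  part. It is Krein-orthogonal to \<open>L\<close> as well, and nondegeneracy gives b = 0.\<close>

lemma M_negative:
  assumes b: "b \<in> M" "b \<noteq> 0"
  shows "Re (krein b b) < 0"
proof (rule ccontr)
  assume "\<not> Re (krein b b) < 0"
  then have 0: "Re (krein b b) = 0"
    using M_nonpos[OF b(1)] by simp
  have M: "Re (krein b y) = 0" if "y \<in> M" for y
  proof -
    \<comment> \<open>The quadratic is -[b + t y, b + t y] for real t. Its constant coefficient is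
      0, so the inequality leaves no room for the linear one.\<close>
    have "(- Re (krein b y))\<^sup>2 \<le> (- Re (krein b b)) * (- Re (krein y y))"
    proof (rule discriminant_le_0)
      fix t
      have sym: "Re (krein y b) = Re (krein b y)"
        by (metis krein_commute complex_cnj(1) cnj.sel(1))
      have "b + complex_of_real t *\<^sub>C y \<in> M"
        using b that subspace_M
        by (simp add: complex_vector.subspace_add complex_vector.subspace_scale)
      from M_nonpos[OF this]
      show "0 \<le> - Re (krein b b) + 2 * t * (- Re (krein b y)) + t\<^sup>2 * (- Re (krein y y))"
        by (simp add: krein_simps sym power2_eq_square algebra_simps)
    qed
    with 0 show ?thesis by simp
  qed
  have "b = 0"
  proof (rule krein_nondegenerate)
    fix y
    have "krein b y = krein b (P y) + krein b (y - P y)"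
      by (simp flip: krein_add_right)
    then show "Re (krein b y) = 0"
      using orth'[OF P_in b(1)] M[OF Q_in] by simp
  qed
  with b show False by simp
qed

text \<open>The candidate for \<open>C\<close>: the identity on \<open>L\<close> and minus the
  identity on \<open>M\<close>.\<close>

definition "reflection z = P z - (z - P z)"

lemma reflection_add: "a \<in> L \<Longrightarrow> b \<in> M \<Longrightarrow> reflection (a + b) = a - b"
  by (simp add: reflection_def P_add)

lemma reflection_reflection: "reflection \<circ> reflection = id"
proof
  fix z
  have "reflection (P z + - (z - P z)) = P z - - (z - P z)"
    by (rule reflection_add[OF P_in complex_vector.subspace_neg[OF subspace_M Q_in]])
  moreover have "reflection z = P z + - (z - P z)"
    by (simp add: reflection_def)
  ultimately show "(reflection \<circ> reflection) z = id z"
    by simp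
qed

lemma bounded_clinear_reflection: "bounded_clinear reflection"
proof -
  have "bounded_linear P"
    using bounded_clinear_P by (simp add: bounded_clinear_def)
  then have "bounded_linear reflection"
    unfolding reflection_def by (intro bounded_linear_sub bounded_linear_ident)
  then show ?thesis
    by (simp add: bounded_clinear_def reflection_def bounded_clinear_scaleC[OF bounded_clinear_P]
        complex_vector.scale_right_diff_distrib)
qed

text \<open>Reversing the sign on \<open>M\<close> turns the indefinite form into a difference whose
  subtracted term is negative definite, so the result is positive definite.\<close>

lemma positive_reflection: "positive_operator (J \<circ> reflection)"
proof -
  have form: "krein (reflection x) y = krein (P x) (P y) - krein (x - P x) (y - P y)" for x y
  proof -
    have "krein (a - b) (a' + b') = krein a a' - krein b b'"
      if "a \<in> L" "b \<in> M" "a' \<in> L" "b' \<in> M" for a b a' b'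
      using that by (simp add: krein_simps orth orth')
    from this[OF P_in[of x] Q_in[of x] P_in[of y] Q_in[of y]] show ?thesis
      by (simp add: reflection_def)
  qed
  \<comment> \<open>Hermitian symmetry of this form is self-adjointness of J composed with
    \<open>reflection\<close>.\<close>
  have "krein (reflection x) y = cnj (krein (reflection y) x)" for x y
    unfolding form by (metis krein_commute complex_cnj_diff)
  then have "cinner (J (reflection x)) y = cinner x (J (reflection y))" for x y
    by (metis cinner_commute krein_inner_def)
  then have "bounded_self_adjoint (J \<circ> reflection)"
    by (simp add: bounded_self_adjoint_iff
        bounded_clinear_comp[OF bounded_clinear_J bounded_clinear_reflection])
  moreover have "Re (cinner (J (reflection x)) x) > 0" if "x \<noteq> 0" for x
  proof -
    have eq: "Re (cinner (J (reflection x)) x) = Re (krein (P x) (P x)) - Re (krein (x - P x) (x - P x))"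
      using form[of x x] by (simp add: krein_inner_def)
    have nonneg: "Re (krein (P x) (P x)) \<ge> 0"
      using \<alpha>_le[OF P_in] \<alpha>_pos by (smt (verit) mult_nonneg_nonneg zero_le_power2)
    show ?thesis
    \<comment> \<open>For x in \<open>L\<close>, strictness comes from uniform positivity; otherwise
      the component in \<open>M\<close> is nonzero and \<open>M_negative\<close> supplies
      it.\<close>
    proof (cases "x - P x = 0")
      case True
      then have "\<alpha> * (norm (P x))\<^sup>2 > 0"
        using that \<alpha>_pos by simp
      then show ?thesis
        using True eq \<alpha>_le[OF P_in, of x]
        by (simp add: krein_zero_left)
    next
      case False
      then show ?thesis
        using M_negative[OF Q_in] nonneg eq by fastforce
    qed
  qed
  ultimately show ?thesis
    by (simp add: positive_operator_def)
qed

end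

section \<open>Equivalence of C-symmetry and decomposability\<close>

theorem proposition3p2:
  fixes J :: "'a::complex_hilbert_space \<Rightarrow> 'a"
    and A :: "'a \<rightharpoonup> 'a"
  assumes "fundamental_symmetry J"
    and "infinite_dimensional (range (P_plus J))"
    and "infinite_dimensional (range (P_minus J))"
    and "J_self_adjoint J A"
  shows "has_C_symmetry J A \<longleftrightarrow>
    (\<exists>L_plus L_minus. maximal_uniformly_positive J L_plus \<and>
      L_minus = krein_complement J L_plus \<and>
      krein_direct_sum J UNIV L_plus L_minus \<and>
      decomposes A L_plus L_minus)"
proof -
  interpret krein_space J
    by unfold_locales (rule assms(1))
  have A: "linear_operator A"
    using assms(4) by (simp add: J_self_adjoint_def)
  show ?thesis
  proof
    assume "has_C_symmetry J A"
    then obtain C where C: "bounded_clinear C" "C \<circ> C = id" "positive_operator (J \<circ> C)"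
      and comm: "A \<circ>\<^sub>m everywhere C = everywhere C \<circ>\<^sub>m A"
      by (auto simp: has_C_symmetry_def)
    show "\<exists>L_plus L_minus. maximal_uniformly_positive J L_plus \<and>
      L_minus = krein_complement J L_plus \<and>
      krein_direct_sum J UNIV L_plus L_minus \<and>
      decomposes A L_plus L_minus"
      \<comment> \<open>The eigenspaces of \<open>C\<close> for 1 and -1 serve as
        \<open>L_plus\<close> and \<open>L_minus\<close>.\<close>
      using C_symmetry_imp_splitting[OF C] commutes_imp_decomposes[OF C(1,2) A comm] by metis
  next
    assume "\<exists>L_plus L_minus. maximal_uniformly_positive J L_plus \<and>
      L_minus = krein_complement J L_plus \<and>
      krein_direct_sum J UNIV L_plus L_minus \<and>
      decomposes A L_plus L_minus"
    then obtain L M where max: "maximal_uniformly_positive J L"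
      and M: "M = krein_complement J L" and split: "krein_direct_sum J UNIV L M"
      and dec: "decomposes A L M"
      by auto
    from max obtain \<alpha> where L: "csubspace L" and \<alpha>: "\<alpha> > 0"
      "\<And>x. x \<in> L \<Longrightarrow> \<alpha> * (norm x)\<^sup>2 \<le> Re (krein_inner J x x)"
      by (auto simp: maximal_uniformly_positive_def uniformly_positive_def closed_csubspace_def)
    have M': "csubspace M"
      unfolding M by (rule csubspace_krein_complement)
    obtain P where "\<And>z. P z \<in> L" "\<And>z. z - P z \<in> M"
      "\<And>a b. a \<in> L \<Longrightarrow> b \<in> M \<Longrightarrow> P (a + b) = a"
      using direct_sum_projection[OF _ L M'] split by (auto simp: krein_direct_sum_def)
    then interpret maximal_splitting J L M P \<alpha>
      by unfold_locales (use max split L M' \<alpha> in auto)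
    \<comment> \<open>The witness is \<open>reflection\<close>; the decomposition of
      \<open>A\<close> makes it commute with \<open>A\<close>.\<close>
    show "has_C_symmetry J A"
      unfolding has_C_symmetry_def
      using bounded_clinear_reflection reflection_reflection positive_reflection
        decomposes_imp_commutes[OF A dec reflection_reflection reflection_add] by blast
  qed
qed

end
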